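(* Let $n\ge 2$ be an integer, $\lambda\ge 0$ and $c_0>0$. Then there exist infinitely many functions $h\in C^2((0,\infty);\mathbb{R}^+)$ satisfying $$2r^2h(r)h_{rr}(r)=(n-1)h(r)(h(r)-1)+rh_r(r)\big(rh_r(r)-\lambda r-(n-1)\big),\quad h(r)>0,\quad\text{for all } r\in(0,\infty),$$ and $\lim_{r\to0^+}r^{\sqrt{n}-1}h(r)=c_0$.
   Context: Subscripts $r$ denote derivatives with respect to $r$; $\mathbb{R}^+=(0,\infty)$. *)

theory Defs
  imports "HOL-Analysis.Analysis" "HOL-Library.FuncSet"
begin

(* Intended for open S, where deriv only sees values of the function on S. *)
definition C2_on :: "(real \<Rightarrow> real) \<Rightarrow> real set \<Rightarrow> bool" where
  "C2_on f S \<longleftrightarrow>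
     f differentiable_on S \<and> deriv f differentiable_on S \<and> continuous_on S (deriv (deriv f))"

(* The functions are taken in the extensional function space on (0,\<infinity>), so that two elements
   of the set are equal iff they agree on (0,\<infinity>); counting total functions real \<Rightarrow> real
   would make infinitude trivial by changing values at r \<le> 0. *)
definition solutions :: "nat \<Rightarrow> real \<Rightarrow> real \<Rightarrow> (real \<Rightarrow> real) set" where
  "solutions n lam c0 =
     {h \<in> {0<..} \<rightarrow>\<^sub>E {0<..}.
        C2_on h {0<..} \<and>
        (\<forall>r>0. 2 * r\<^sup>2 * h r * deriv (deriv h) r =
                 (real n - 1) * h r * (h r - 1)
                 + r * deriv h r * (r * deriv h r - lam * r - (real n - 1))
               \<and> h r > 0) \<and>
        ((\<lambda>r. r powr (sqrt (real n) - 1) * h r) \<longlongrightarrow> c0) (at_right 0)}"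

end

theory Submission
  imports Defs
begin

text \<open>
  Put N = sqrt n, m = n - 1, t = ln r and h = r^(1-N) G(t)^2. The equation becomes the first-order
  system G' = X + e^((N-1)t) (lam e^t + m) / (2G), X' = N X + e^((N-1)t) (mN + lam e^t (N-1)) / (4G)
  and the boundary condition becomes G(-infinity) = sqrt c0. Without the terms in 1/G its
  solutions are W = sqrt c0 + e exp(Nt), with a free parameter e, and variation of constants gives
  G = W + J1 - exp(Nt) J2, where J1 integrates exp((N-1)s) P/G over (-infinity, t] and J2 integrates
  exp(-s) Q/G over [t, infinity), with P and Q affine in e^s. As W dominates K e^(\<eta>s) (1 + e^s)
  for \<eta> = (N-1)/2, with K as large as desired once e is large, this is a contraction for G/W on the
  bounded continuous functions on the whole line. So large e yields solutions that are global from
  the outset, and G >= W/2 makes h(1) tend to infinity with e.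
\<close>

section \<open>Integrals over half-lines with exponentially bounded integrands\<close>

text \<open>Half-lines in both directions are covered: the integral of f over everything up to t is
  the tail from -t of the reflected function s \<mapsto> f (-s). This is why minus signs appear in
  pairs below.\<close>

definition tail :: "(real \<Rightarrow> real) \<Rightarrow> real \<Rightarrow> real" where
  "tail f t = integral {t..} f"

lemma tail_integrable:
  fixes f :: "real \<Rightarrow> real"
  assumes "continuous_on UNIV f" "\<mu> > 0" "\<And>s. \<bar>f s\<bar> \<le> M * exp (- \<mu> * s)"
  shows "f integrable_on {t..}"
proof (rule measurable_bounded_by_integrable_imp_integrable)
  show "f \<in> borel_measurable (lebesgue_on {t..})"
    by (rule continuous_imp_measurable_on_sets_lebesgue)
       (use assms(1) in \<open>auto intro: continuous_on_subset\<close>)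
  show "(\<lambda>s. M * exp (- \<mu> * s)) integrable_on {t..}"
    using integrable_on_exp_minus_to_infinity[OF assms(2)] by (rule integrable_on_mult_right)
  show "norm (f s) \<le> M * exp (- \<mu> * s)" if "s \<in> {t..}" for s
    using assms(3) by simp
qed auto

lemma tail_bound:
  fixes f :: "real \<Rightarrow> real"
  assumes "continuous_on UNIV f" "\<mu> > 0" "\<And>s. \<bar>f s\<bar> \<le> M * exp (- \<mu> * s)"
  shows "\<bar>tail f t\<bar> \<le> M / \<mu> * exp (- \<mu> * t)"
proof -
  have I: "((\<lambda>s. M * exp (- \<mu> * s)) has_integral M * (exp (- \<mu> * t) / \<mu>)) {t..}"
    by (intro has_integral_mult_right has_integral_exp_minus_to_infinity assms)
  have "norm (integral {t..} f) \<le> integral {t..} (\<lambda>s. M * exp (- \<mu> * s))"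
    using assms(3) I
    by (intro integral_norm_bound_integral tail_integrable[OF assms]) auto
  then show ?thesis
    using integral_unique[OF I] by (simp add: tail_def)
qed

lemma tail_diff:
  assumes "continuous_on UNIV f" "\<mu> > 0" "\<And>s. \<bar>f s\<bar> \<le> M * exp (- \<mu> * s)"
    and "continuous_on UNIV g" "\<And>s. \<bar>g s\<bar> \<le> M * exp (- \<mu> * s)"
  shows "tail f t - tail g t = tail (\<lambda>s. f s - g s) t"
  unfolding tail_def
  using tail_integrable[OF assms(1-3)] tail_integrable[OF assms(4,2,5)]
  by (simp add: integral_diff)

text \<open>Near t, cutting the half-line at t + 1 leaves a constant plus an integral over a compact
  interval, to which the fundamental theorem of calculus applies. The minus sign comes from t being
  the lower limit.\<close>

lemma tail_has_derivative:
  fixes f :: "real \<Rightarrow> real"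
  assumes "continuous_on UNIV f" "\<mu> > 0" "\<And>s. \<bar>f s\<bar> \<le> M * exp (- \<mu> * s)"
  shows "(tail f has_real_derivative - f t) (at t)"
proof -
  have split: "tail f x = tail f (t + 1) + integral {x..t+1} f" if "x < t + 1" for x
  proof -
    have "{x..} = {x..t+1} \<union> {t+1..}" using that by auto
    moreover have "{x..t+1} \<inter> {t+1..} = {t+1}" using that by auto
    ultimately show ?thesis
      unfolding tail_def using tail_integrable[OF assms] assms(1)
      by (subst integral_Un[symmetric, of f "{x..t+1}" "{t+1..}"] | simp add: add.commute
          integrable_continuous_interval continuous_on_subset[OF assms(1)])+
  qed
  have "((\<lambda>x. integral {x..t+1} f) has_real_derivative - f t) (at t within {t-1..t+1})"
    by (rule integral_has_real_derivative') (auto intro: continuous_on_subset[OF assms(1)])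
  moreover have "at t within {t-1..t+1} = at t"
    by (rule at_within_interior) auto
  ultimately have "((\<lambda>x. integral {x..t+1} f) has_real_derivative - f t) (at t)" by simp
  then have "((\<lambda>x. tail f (t+1) + integral {x..t+1} f) has_real_derivative - f t) (at t)"
    by (auto intro!: derivative_eq_intros)
  then show ?thesis
    by (rule has_field_derivative_transform_within_open[where S = "{..<t+1}"]) (auto simp: split)
qed

section \<open>The integral equation as a fixed point problem\<close>

text \<open>The unknown is the quotient \<phi> of the solution by W, so that a and b already contain
  a factor 1/W in the application. Both correction terms are of order exp (\<eta> t): the prefactor
  with exponent 2\<eta> + 1 turns the decay rate \<eta> + 1 of the second tail into growth rate
  \<eta>. The lower bound on W absorbs this growth, uniformly in t.\<close>

lemma tail_fixed_point:
  fixes a b W :: "real \<Rightarrow> real" and \<eta> A K :: real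
  assumes cont: "continuous_on UNIV a" "continuous_on UNIV b" "continuous_on UNIV W"
    and \<eta>: "\<eta> > 0" and A: "A \<ge> 0" and K: "K > 0" "16 * A \<le> \<eta> * K"
    and a: "\<And>s. \<bar>a s\<bar> \<le> A * exp (\<eta> * s)"
    and b: "\<And>s. \<bar>b s\<bar> \<le> A * exp (- (\<eta> + 1) * s)"
    and W: "\<And>s. W s \<ge> K * exp (\<eta> * s)"
  obtains \<phi> where "continuous_on UNIV \<phi>" "\<And>t. \<phi> t \<ge> 1/2"
    "\<And>t. \<phi> t * W t = W t + tail (\<lambda>s. a (- s) / \<phi> (- s)) (- t)
        - exp ((2*\<eta>+1) * t) * tail (\<lambda>s. b s / \<phi> s) t"
    "\<And>t. \<bar>\<phi> t * W t - W t\<bar> \<le> 4 * A / \<eta> * exp (\<eta> * t)"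
proof -
  \<comment> \<open>Here f stands for the reciprocal of \<phi>. In this variable the correction is
    linear, so one estimate on \<open>S\<close> serves both for boundedness and for
    contraction.\<close>
  define S where "S f t = tail (\<lambda>s. a (- s) * f (- s)) (- t)
      - exp ((2*\<eta>+1) * t) * tail (\<lambda>s. b s * f s) t" for f t
  have W0: "W s > 0" for s
    using W[of s] mult_pos_pos[OF K(1), of "exp (\<eta> * s)"] by simp
  have bd_a: "\<bar>a (- s) * f (- s)\<bar> \<le> M * A * exp (- \<eta> * s)" if "\<And>s. \<bar>f s\<bar> \<le> M" for f M s
    using mult_mono[OF a[of "- s"] that[of "- s"]] A by (simp add: abs_mult mult_ac)
  have bd_b: "\<bar>b s * f s\<bar> \<le> M * A * exp (- (\<eta> + 1) * s)" if "\<And>s. \<bar>f s\<bar> \<le> M" for f M s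
    using mult_mono[OF b[of "s"] that[of "s"]] A by (simp add: abs_mult mult_ac)
  have ct_a: "continuous_on UNIV (\<lambda>s. a (- s) * f (- s))" if "continuous_on UNIV f" for f
    by (intro continuous_intros continuous_on_compose2[OF cont(1)] continuous_on_compose2[OF that]) auto
  have ct_b: "continuous_on UNIV (\<lambda>s. b s * f s)" if "continuous_on UNIV f" for f
    by (intro continuous_intros cont that)
  have S_bound: "\<bar>S f t\<bar> \<le> 2 * M * A / \<eta> * exp (\<eta> * t)"
    if f: "continuous_on UNIV f" "\<And>s. \<bar>f s\<bar> \<le> M" for f M t
  proof -
    have M: "M \<ge> 0" using f(2)[of 0] by simp
    have 1: "\<bar>tail (\<lambda>s. a (- s) * f (- s)) (- t)\<bar> \<le> M * A / \<eta> * exp (\<eta> * t)"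
      using tail_bound[OF ct_a[OF f(1)] \<eta> bd_a[of f, OF f(2)], of "- t"] by simp
    have 2: "\<bar>tail (\<lambda>s. b s * f s) t\<bar> \<le> M * A / (\<eta>+1) * exp (- (\<eta>+1) * t)"
      using tail_bound[OF ct_b[OF f(1)] _ bd_b[of f, OF f(2)], of t] \<eta> by simp
    have "\<bar>exp ((2*\<eta>+1) * t) * tail (\<lambda>s. b s * f s) t\<bar>
        \<le> exp ((2*\<eta>+1) * t) * (M * A / (\<eta>+1) * exp (- (\<eta>+1) * t))"
      using mult_left_mono[OF 2, of "exp ((2*\<eta>+1) * t)"] by (simp add: abs_mult)
    also have "\<dots> = M * A / (\<eta>+1) * exp ((2*\<eta>+1) * t + - (\<eta>+1) * t)"
      unfolding exp_add by simp
    also have "(2*\<eta>+1) * t + - (\<eta>+1) * t = \<eta> * t" by (simp add: algebra_simps)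
    \<comment> \<open>Weakening \<eta> + 1 to \<eta> makes the two bounds equal, whence the factor 2
      in the claim.\<close>
    also have "M * A / (\<eta>+1) * exp (\<eta> * t) \<le> M * A / \<eta> * exp (\<eta> * t)"
      using M A \<eta> by (intro mult_right_mono divide_left_mono) auto
    finally show ?thesis using 1 unfolding S_def by simp
  qed
  have S_diff: "S f t - S g t = S (\<lambda>s. f s - g s) t"
    if f: "continuous_on UNIV f" "\<And>s. \<bar>f s\<bar> \<le> M"
    and g: "continuous_on UNIV g" "\<And>s. \<bar>g s\<bar> \<le> M" for f g M t
  proof -
    have 1: "tail (\<lambda>s. a (- s) * f (- s)) (- t) - tail (\<lambda>s. a (- s) * g (- s)) (- t)
        = tail (\<lambda>s. a (- s) * (f (- s) - g (- s))) (- t)"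
      using tail_diff[OF ct_a[OF f(1)] \<eta> bd_a[of f, OF f(2)] ct_a[OF g(1)] bd_a[of g, OF g(2)], of "- t"]
      by (simp add: algebra_simps)
    have 2: "tail (\<lambda>s. b s * f s) t - tail (\<lambda>s. b s * g s) t = tail (\<lambda>s. b s * (f s - g s)) t"
      using tail_diff[OF ct_b[OF f(1)] _ bd_b[of f, OF f(2)] ct_b[OF g(1)] bd_b[of g, OF g(2)], of t] \<eta>
      by (simp add: algebra_simps)
    show ?thesis unfolding S_def 1[symmetric] 2[symmetric] by (simp add: algebra_simps)
  qed
  have S_cont: "continuous_on UNIV (S f)" if f: "continuous_on UNIV f" "\<And>s. \<bar>f s\<bar> \<le> M" for f M
  proof -
    have 1: "continuous_on UNIV (tail (\<lambda>s. a (- s) * f (- s)))"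
      using tail_has_derivative[OF ct_a[OF f(1)] \<eta> bd_a[of f, OF f(2)]]
      by (meson DERIV_isCont continuous_at_imp_continuous_on)
    have 2: "continuous_on UNIV (tail (\<lambda>s. b s * f s))"
      using tail_has_derivative[OF ct_b[OF f(1)] _ bd_b[of f, OF f(2)]] \<eta>
      by (meson DERIV_isCont continuous_at_imp_continuous_on add_pos_pos zero_less_one)
    show ?thesis unfolding S_def
      by (intro continuous_intros continuous_on_compose2[OF 1] 2) auto
  qed
  \<comment> \<open>Truncating at 1/2 makes the reciprocal globally Lipschitz; the fixed point stays above 1/2.\<close>
  define q where "q f = (\<lambda>s. 1 / max (1/2) (f s))" for f :: "real \<Rightarrow> real"
  have q_cont: "continuous_on UNIV (q f)" if "continuous_on UNIV f" for f
    unfolding q_def by (intro continuous_intros that) (auto simp: max_def)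
  have q_bound: "\<bar>q f s\<bar> \<le> 2" for f s
    unfolding q_def by (auto simp: max_def field_simps)
  have q_lip: "\<bar>q f s - q g s\<bar> \<le> 4 * \<bar>f s - g s\<bar>" for f g s
  proof -
    define x y where "x = max (1/2) (f s)" and "y = max (1/2) (g s)"
    have xy: "x \<ge> 1/2" "y \<ge> 1/2" "\<bar>x - y\<bar> \<le> \<bar>f s - g s\<bar>" by (auto simp: x_def y_def)
    then have "x * y \<ge> 1/2 * (1/2)" by (intro mult_mono) auto
    then have "\<bar>y - x\<bar> / (x * y) \<le> \<bar>y - x\<bar> / (1/4)"
      by (intro divide_left_mono) auto
    moreover have "q f s - q g s = (y - x) / (x * y)"
      using xy by (simp add: q_def x_def[symmetric] y_def[symmetric] field_simps)
    moreover have "\<bar>x * y\<bar> = x * y" using xy by simp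
    ultimately show ?thesis using xy(3) by (simp only: abs_divide) (simp add: abs_minus_commute)
  qed
  \<comment> \<open>By 16 A \<le> \<eta> K, applying \<open>S\<close> and dividing by W shrinks sup
    bounds by the factor 8.\<close>
  have ratio: "\<bar>S f t / W t\<bar> \<le> M / 8" if f: "continuous_on UNIV f" "\<And>s. \<bar>f s\<bar> \<le> M" for f M t
  proof -
    have M: "M \<ge> 0" using f(2)[of 0] by simp
    have "2 * A / \<eta> \<le> K / 8" using K \<eta> by (simp add: field_simps)
    then have "M * (2 * A / \<eta>) * exp (\<eta> * t) \<le> M * (K / 8) * exp (\<eta> * t)"
      using M by (intro mult_right_mono mult_left_mono) auto
    also have "\<dots> = M / 8 * (K * exp (\<eta> * t))" by simp
    also have "\<dots> \<le> M / 8 * W t" using M W by (intro mult_left_mono) auto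
    also have "M * (2 * A / \<eta>) * exp (\<eta> * t) = 2 * M * A / \<eta> * exp (\<eta> * t)" by simp
    finally have "\<bar>S f t\<bar> \<le> M / 8 * W t" using S_bound[OF f, of t] by linarith
    then show ?thesis using W0[of t] by (simp add: abs_divide field_simps)
  qed
  define T where "T \<phi> = Bcontfun (\<lambda>t. 1 + S (q (apply_bcontfun \<phi>)) t / W t)" for \<phi> :: "real \<Rightarrow>\<^sub>C real"
  have T: "apply_bcontfun (T \<phi>) t = 1 + S (q (apply_bcontfun \<phi>)) t / W t" for \<phi> t
  proof -
    \<comment> \<open>\<open>Bcontfun\<close> can be inverted only on bounded continuous functions,
      so membership must be shown before \<open>T\<close> can be evaluated pointwise.\<close>
    have "(\<lambda>t. 1 + S (q (apply_bcontfun \<phi>)) t / W t) \<in> bcontfun"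
      unfolding bcontfun_def
    proof (safe)
      show "continuous_on UNIV (\<lambda>t. 1 + S (q (apply_bcontfun \<phi>)) t / W t)"
        using W0 by (intro continuous_intros S_cont[OF q_cont q_bound] cont) (auto simp: less_imp_neq[THEN not_sym])
      have "\<bar>S (q (apply_bcontfun \<phi>)) t / W t\<bar> \<le> 2 / 8" for t
        by (intro ratio q_cont q_bound) auto
      moreover have "\<bar>1 + x\<bar> \<le> 2" if "\<bar>x\<bar> \<le> 2 / 8" for x :: real
        using that by linarith
      ultimately have "\<bar>1 + S (q (apply_bcontfun \<phi>)) t / W t\<bar> \<le> 2" for t
        by blast
      then show "bounded (range (\<lambda>t. 1 + S (q (apply_bcontfun \<phi>)) t / W t))"
        by (auto simp: bounded_iff)
    qed
    then show ?thesis unfolding T_def by (simp add: Bcontfun_inverse)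
  qed
  have "\<exists>!\<phi>. T \<phi> = \<phi>"
  proof (rule banach_fix_type[of "1/2"])
    show "\<forall>x y. dist (T x) (T y) \<le> 1/2 * dist x y"
    proof (intro allI dist_bound)
      fix x y :: "real \<Rightarrow>\<^sub>C real" and t
      have d: "\<bar>q (apply_bcontfun x) s - q (apply_bcontfun y) s\<bar> \<le> 4 * dist x y" for s
        using q_lip[of "apply_bcontfun x" s "apply_bcontfun y"] dist_bounded[of x s y]
        by (simp add: dist_real_def)
      have "dist (T x t) (T y t) = \<bar>(S (q (apply_bcontfun x)) t - S (q (apply_bcontfun y)) t) / W t\<bar>"
        by (simp add: T dist_real_def diff_divide_distrib)
      also have "S (q (apply_bcontfun x)) t - S (q (apply_bcontfun y)) t
          = S (\<lambda>s. q (apply_bcontfun x) s - q (apply_bcontfun y) s) t"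
        by (rule S_diff) (auto intro: q_cont q_bound)
      \<comment> \<open>The Lipschitz constant 4 of the truncated reciprocal times the factor 1/8 of
        \<open>ratio\<close> is the contraction constant 1/2.\<close>
      also have "\<bar>\<dots> / W t\<bar> \<le> 4 * dist x y / 8"
        by (rule ratio) (auto intro!: q_cont continuous_intros d)
      finally show "dist (T x t) (T y t) \<le> 1/2 * dist x y" by simp
    qed
  qed auto
  then obtain \<phi> where T_fixed: "T \<phi> = \<phi>" by blast
  have eq: "\<phi> t = 1 + S (q (apply_bcontfun \<phi>)) t / W t" for t
    using T[of \<phi> t] T_fixed by simp
  \<comment> \<open>The truncated reciprocal is at most 2, so the correction is at most 1/4 and the
    truncation is inactive at the fixed point.\<close>
  have "\<bar>S (q (apply_bcontfun \<phi>)) t / W t\<bar> \<le> 2 / 8" for t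
    by (intro ratio q_cont q_bound) auto
  moreover have "1 + x \<ge> 1 / 2" if "\<bar>x\<bar> \<le> 2 / 8" for x :: real
    using that by linarith
  ultimately have ge: "\<phi> t \<ge> 1/2" for t
    using eq[of t] by metis
  have q_eq: "q (apply_bcontfun \<phi>) = (\<lambda>s. 1 / \<phi> s)"
    using ge by (auto simp: q_def max_def)
  have eq': "\<phi> t * W t = W t + S (\<lambda>s. 1 / \<phi> s) t" for t
    using eq[of t] W0[of t] unfolding q_eq by (simp add: field_simps)
  show ?thesis
  proof (rule that[of "apply_bcontfun \<phi>"])
    show "\<phi> t * W t = W t + tail (\<lambda>s. a (- s) / \<phi> (- s)) (- t)
        - exp ((2*\<eta>+1) * t) * tail (\<lambda>s. b s / \<phi> s) t" for t
      using eq'[of t] by (simp add: S_def)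
    show "\<bar>\<phi> t * W t - W t\<bar> \<le> 4 * A / \<eta> * exp (\<eta> * t)" for t
      using S_bound[of "q (apply_bcontfun \<phi>)" 2 t, OF q_cont q_bound] eq'[of t] by (simp add: q_eq)
    show "\<phi> t \<ge> 1/2" for t
      by (rule ge)
  qed auto
qed

section \<open>Growth of the unperturbed solution W\<close>

text \<open>The exponents \<eta> and \<eta> + 1 on the left lie strictly between the exponents 0 and
  2\<eta> + 1 on the right. The constant c wins for very negative s, and a large e takes care of all
  other s.\<close>

lemma weight_dominates:
  fixes c K \<eta> :: real
  assumes "\<eta> > 0" "c > 0" "K > 0"
  obtains e0 where "e0 > 0"
    "\<And>e s. e \<ge> e0 \<Longrightarrow> K * exp (\<eta> * s) * (1 + exp s) \<le> c + e * exp ((2*\<eta>+1) * s)"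
proof
  \<comment> \<open>To the left of \<open>s0\<close> both K exp (\<eta> s) \<le> c/2 and 1 + exp s
    \<le> 2 hold. The value \<open>e0\<close> is the left side divided by exp ((2\<eta>+1) s), taken
    at \<open>s0\<close>; this quotient decreases in s.\<close>
  define s0 where "s0 = min 0 (ln (c / (2*K)) / \<eta>)"
  define e0 where "e0 = K * (exp (- (\<eta>+1) * s0) + exp (- \<eta> * s0))"
  show "e0 > 0" using assms by (auto simp: e0_def intro!: mult_pos_pos add_pos_pos)
  fix e s :: real
  assume e: "e \<ge> e0"
  show "K * exp (\<eta> * s) * (1 + exp s) \<le> c + e * exp ((2*\<eta>+1) * s)"
  proof (cases "s \<le> s0")
    case True
    then have "s \<le> ln (c / (2*K)) / \<eta>" "s \<le> 0" by (auto simp: s0_def)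
    then have "exp (\<eta> * s) \<le> exp (ln (c / (2*K)))" "exp s \<le> 1"
      using assms(1) by (simp_all add: field_simps)
    then have "exp (\<eta> * s) * (1 + exp s) \<le> c / (2*K) * 2"
      using assms by (intro mult_mono) (auto simp: add_nonneg_nonneg)
    then have "K * (exp (\<eta> * s) * (1 + exp s)) \<le> K * (c / (2*K) * 2)"
      using assms by (intro mult_left_mono) auto
    moreover have "e * exp ((2*\<eta>+1) * s) \<ge> 0" using e \<open>e0 > 0\<close> by simp
    ultimately show ?thesis using assms by (simp add: mult.assoc)
  next
    case False
    have "exp (- (\<eta>+1) * s) \<le> exp (- (\<eta>+1) * s0)" "exp (- \<eta> * s) \<le> exp (- \<eta> * s0)"
      using False assms by auto
    then have "K * (exp (- (\<eta>+1) * s) + exp (- \<eta> * s)) \<le> e0"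
      unfolding e0_def using assms by (intro mult_left_mono add_mono) auto
    then have le: "exp ((2*\<eta>+1) * s) * (K * (exp (- (\<eta>+1) * s) + exp (- \<eta> * s)))
        \<le> exp ((2*\<eta>+1) * s) * e"
      using e by (intro mult_left_mono) auto
    have eq: "exp ((2*\<eta>+1) * s) * (K * (exp (- (\<eta>+1) * s) + exp (- \<eta> * s)))
        = K * exp (\<eta> * s) * (1 + exp s)"
    proof -
      have "exp ((2*\<eta>+1) * s) * exp (- (\<eta>+1) * s) = exp (\<eta> * s)"
        unfolding exp_add[symmetric] by (simp add: algebra_simps)
      moreover have "exp ((2*\<eta>+1) * s) * exp (- \<eta> * s) = exp (\<eta> * s) * exp s"
        unfolding exp_add[symmetric] by (simp add: algebra_simps)
      ultimately show ?thesis
        by (simp add: distrib_left mult.left_commute[of _ K])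
    qed
    show ?thesis
      using le[unfolded eq] assms(2) unfolding mult.commute[of e] by linarith
  qed
qed

section \<open>From first-order systems back to the second-order equation\<close>

text \<open>Here z = 2 r^(1-N) G X in terms of the system above.\<close>
lemma first_order_system_in_solutions:
  fixes h z :: "real \<Rightarrow> real" and lam c0 :: real and n :: nat
  defines "N \<equiv> sqrt (real n)" and "m \<equiv> real n - 1"
  assumes h_pos: "\<And>r. r > 0 \<Longrightarrow> h r > 0"
    and h': "\<And>r. r > 0 \<Longrightarrow> (h has_real_derivative ((1 - N) * h r + z r + lam * r + m) / r) (at r)"
    and z': "\<And>r. r > 0 \<Longrightarrow> (z has_real_derivative
        (z r + (z r)\<^sup>2 / (2 * h r) + (lam * r + m) * z r / (2 * h r)
          + (m * N + lam * r * (N - 1)) / 2) / r) (at r)"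
    and lim: "((\<lambda>r. r powr (N - 1) * h r) \<longlongrightarrow> c0) (at_right 0)"
  shows "restrict h {0<..} \<in> solutions n lam c0"
proof -
  let ?h = "restrict h {0<..}"
  \<comment> \<open>These are the values of h', z' and h'', the last by the quotient rule. Having
    h'' explicitly in terms of r, h and z gives its continuity as well as the equation.\<close>
  define k where "k r = ((1 - N) * h r + z r + lam * r + m) / r" for r
  define l where "l r = (z r + (z r)\<^sup>2 / (2 * h r) + (lam * r + m) * z r / (2 * h r)
          + (m * N + lam * r * (N - 1)) / 2) / r" for r
  define k' where "k' r = ((1 - N) * k r + l r + lam) / r - k r / r" for r
  have rh': "(?h has_real_derivative k r) (at r)" if "r > 0" for r
    unfolding k_def using that
    by (intro has_field_derivative_transform_within_open[OF h'[OF that], of "{0<..}"]) auto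
  have dh: "deriv ?h r = k r" if "r > 0" for r
    using rh'[OF that] by (rule DERIV_imp_deriv)
  have dk: "(k has_real_derivative k' r) (at r)" if "r > 0" for r
    unfolding k_def[abs_def] k'_def l_def using that
    by (auto intro!: derivative_eq_intros h' z' simp: field_simps)
  have ddh: "(deriv ?h has_real_derivative k' r) (at r)" if "r > 0" for r
    using that by (intro has_field_derivative_transform_within_open[OF dk[OF that], of "{0<..}"]) (auto simp: dh)
  have dd: "deriv (deriv ?h) r = k' r" if "r > 0" for r
    using ddh[OF that] by (rule DERIV_imp_deriv)
  have ch: "continuous_on {0<..} h" "continuous_on {0<..} z"
    using h' z' by (auto intro!: continuous_at_imp_continuous_on DERIV_isCont)
  have "continuous_on {0<..} k"
    unfolding k_def by (intro continuous_intros ch) auto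
  then have "continuous_on {0<..} k'"
    unfolding k'_def l_def by (intro continuous_intros ch) (auto dest: h_pos)
  then have "continuous_on {0<..} (deriv (deriv ?h))"
    by (rule continuous_on_eq) (simp add: dd)
  moreover have "?h differentiable_on {0<..}" "deriv ?h differentiable_on {0<..}"
    using rh' ddh by (meson differentiable_at_imp_differentiable_on greaterThan_iff real_differentiable_def)+
  ultimately have C2: "C2_on ?h {0<..}" by (simp add: C2_on_def)
  have N: "N\<^sup>2 = real n" by (simp add: N_def)
  have ode: "2 * r\<^sup>2 * h r * k' r = m * h r * (h r - 1) + r * k r * (r * k r - lam * r - m)"
    if r: "r > 0" for r
  proof -
    have hp: "h r > 0" by (rule h_pos[OF r])
    \<comment> \<open>With p = r h' all divisions by r and h can be cleared, and the equation
      becomes a polynomial identity.\<close>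
    define p where "p = r * k r"
    have p: "p = (1 - N) * h r + z r + lam * r + m" using r by (simp add: p_def k_def)
    have "r\<^sup>2 * k' r = (1 - N) * p + r * l r + lam * r - p"
      using r by (simp add: k'_def p_def power2_eq_square field_simps)
    then have "2 * r\<^sup>2 * h r * k' r = 2 * h r * ((1 - N) * p + r * l r + lam * r - p)"
      by (metis mult.assoc mult.commute)
    also have "\<dots> = 2 * h r * (r * l r) + 2 * h r * (lam * r - N * p)"
      by (simp add: algebra_simps)
    also have "2 * h r * (r * l r) = 2 * h r * z r + (z r)\<^sup>2 + (lam * r + m) * z r
        + h r * (m * N + lam * r * (N - 1))"
      using r hp by (simp add: l_def field_simps)
    finally have eq: "2 * r\<^sup>2 * h r * k' r = 2 * h r * z r + (z r)\<^sup>2 + (lam * r + m) * z r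
        + h r * (m * N + lam * r * (N - 1)) + 2 * h r * (lam * r - N * p)" .
    \<comment> \<open>This relation is where the exponent sqrt n matters: it makes the polynomial
      identity close.\<close>
    have m: "m = N\<^sup>2 - 1" using N by (simp add: m_def)
    show ?thesis
      unfolding p_def[symmetric] eq p m by algebra
  qed
  have "((\<lambda>r. r powr (sqrt (real n) - 1) * ?h r) \<longlongrightarrow> c0) (at_right 0)"
    using lim unfolding N_def
    by (rule Lim_transform_eventually) (auto simp: eventually_at_right_less intro!: eventually_at_rightI[of 0 1])
  then show ?thesis
    unfolding solutions_def using C2 ode h_pos by (auto simp: dh dd m_def)
qed

text \<open>With p = r^(1-N), the weight exp ((N-1) t) equals 1/p and cancels the prefactor p of h
  and z. Differentiating the square in h produces 2G, which cancels the 1/G in G'. Multiplying h by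
  r^(N-1) leaves G (ln r) squared, so the boundary condition is read off at t = -infinity.\<close>

lemma integral_system_in_solutions:
  fixes G X :: "real \<Rightarrow> real" and lam c0 :: real and n :: nat
  defines "N \<equiv> sqrt (real n)" and "m \<equiv> real n - 1"
  assumes c0: "c0 > 0" and G_pos: "\<And>t. G t > 0"
    and G': "\<And>t. (G has_real_derivative
        X t + exp ((N - 1) * t) * (lam * exp t + m) / (2 * G t)) (at t)"
    and X': "\<And>t. (X has_real_derivative
        N * X t + exp ((N - 1) * t) * (m * N + lam * exp t * (N - 1)) / (4 * G t)) (at t)"
    and lim: "(G \<longlongrightarrow> sqrt c0) at_bot"
  shows "(\<lambda>r\<in>{0<..}. r powr (1 - N) * (G (ln r))\<^sup>2) \<in> solutions n lam c0"
proof (rule first_order_system_in_solutions[where n = n and z = "\<lambda>r. 2 * r powr (1 - N) * G (ln r) * X (ln r)",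
      folded N_def m_def])
  fix r :: real assume r: "r > 0"
  define p where "p = r powr (1 - N)"
  have p: "p > 0" using r by (simp add: p_def)
  have e: "exp ((N - 1) * ln r) = 1 / p" "exp (ln r) = r"
    using r by (simp_all add: p_def powr_def exp_minus[symmetric] divide_inverse algebra_simps)
  have dp: "((\<lambda>r. r powr (1 - N)) has_real_derivative (1 - N) * p / r) (at r)"
  proof -
    have "r powr (1 - N - 1) = p / r"
      using powr_diff[of r "1 - N" 1] r by (simp add: p_def)
    then show ?thesis
      using has_real_derivative_powr[OF r, of "1 - N"] by (simp only: times_divide_eq_right)
  qed
  have dln: "(ln has_real_derivative 1 / r) (at r)"
    using DERIV_ln_divide[OF r] .
  have dG: "((\<lambda>r. G (ln r)) has_real_derivative
      (X (ln r) + (lam * r + m) / (2 * p * G (ln r))) / r) (at r)"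
    by (rule DERIV_cong[OF DERIV_chain2[OF G'[of "ln r"] dln]], simp only: e) (simp add: mult_ac)
  have dX: "((\<lambda>r. X (ln r)) has_real_derivative
      (N * X (ln r) + (m * N + lam * r * (N - 1)) / (4 * p * G (ln r))) / r) (at r)"
    by (rule DERIV_cong[OF DERIV_chain2[OF X'[of "ln r"] dln]], simp only: e) (simp add: mult_ac)
  show "r powr (1 - N) * (G (ln r))\<^sup>2 > 0" using r G_pos[of "ln r"] by simp
  define g x where "g = G (ln r)" and "x = X (ln r)"
  have g: "g > 0" by (simp add: g_def G_pos)
  show "((\<lambda>r. r powr (1 - N) * (G (ln r))\<^sup>2) has_real_derivative
      ((1 - N) * (r powr (1 - N) * (G (ln r))\<^sup>2) + 2 * r powr (1 - N) * G (ln r) * X (ln r)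
        + lam * r + m) / r) (at r)"
    by (rule derivative_eq_intros dp dG refl)+
      (use r p g in \<open>simp add: p_def[symmetric] g_def[symmetric] x_def[symmetric] field_simps power2_eq_square\<close>)
  show "((\<lambda>r. 2 * r powr (1 - N) * G (ln r) * X (ln r)) has_real_derivative
      (2 * r powr (1 - N) * G (ln r) * X (ln r)
        + (2 * r powr (1 - N) * G (ln r) * X (ln r))\<^sup>2 / (2 * (r powr (1 - N) * (G (ln r))\<^sup>2))
        + (lam * r + m) * (2 * r powr (1 - N) * G (ln r) * X (ln r))
          / (2 * (r powr (1 - N) * (G (ln r))\<^sup>2))
        + (m * N + lam * r * (N - 1)) / 2) / r) (at r)"
    by (rule derivative_eq_intros dp dG dX refl)+
      (use r p g in \<open>simp add: p_def[symmetric] g_def[symmetric] x_def[symmetric] field_simps power2_eq_square\<close>)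
next
  have "filterlim ln at_bot (at_right (0::real))" by (rule ln_at_0)
  then have "((\<lambda>r. (G (ln r))\<^sup>2) \<longlongrightarrow> (sqrt c0)\<^sup>2) (at_right 0)"
    by (intro tendsto_power filterlim_compose[OF lim])
  then have "((\<lambda>r. (G (ln r))\<^sup>2) \<longlongrightarrow> c0) (at_right 0)"
    using c0 by simp
  moreover have "r powr (N - 1) * (r powr (1 - N) * (G (ln r))\<^sup>2) = (G (ln r))\<^sup>2" if "r > 0" for r
    using that by (simp add: mult.assoc[symmetric] powr_add[symmetric])
  then have "\<forall>\<^sub>F r in at_right 0. (G (ln r))\<^sup>2 = r powr (N - 1) * (r powr (1 - N) * (G (ln r))\<^sup>2)"
    by (intro eventually_at_rightI[of 0 1]) (simp_all only: greaterThanLessThan_iff zero_less_one)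
  ultimately show "((\<lambda>r. r powr (N - 1) * (r powr (1 - N) * (G (ln r))\<^sup>2)) \<longlongrightarrow> c0) (at_right 0)"
    by (rule Lim_transform_eventually)
qed

section \<open>Solutions with arbitrarily large value at r = 1\<close>

lemma solution_with_large_value:
  fixes n :: nat and lam c0 M :: real
  assumes n: "n \<ge> 2" and lam: "lam \<ge> 0" and c0: "c0 > 0"
  obtains h where "h \<in> solutions n lam c0" "h 1 \<ge> M"
proof -
  define N m \<eta> where "N = sqrt (real n)" and "m = real n - 1" and "\<eta> = (N - 1) / 2"
  have N: "N > 1" using n by (simp add: N_def)
  then have \<eta>: "\<eta> > 0" and N_eq: "N = 2 * \<eta> + 1" by (simp_all add: \<eta>_def field_simps)
  have m: "m > 0" using n by (simp add: m_def)
  \<comment> \<open>\<open>C\<close> is chosen so that P and Q below are at most C (1 + exp s);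
    dividing by the lower bound for W then gives the constant \<open>A\<close>. As K \<ge> 1, A
    \<le> C, and the choice of \<open>K\<close> yields 16 A \<le> 16 C \<le> \<eta> K.\<close>
  define C K A where "C = m / 4 + lam / 2" and "K = 1 + 16 * C / \<eta>" and "A = C / K"
  have C: "C \<ge> 0" using m lam by (simp add: C_def)
  then have K1: "K \<ge> 1" using \<eta> by (simp add: K_def)
  then have A: "A \<ge> 0" using C by (simp add: A_def)
  have "16 * C \<le> \<eta> * K" using \<eta> C by (simp add: K_def field_simps)
  moreover have "16 * A \<le> 16 * C"
    using mult_left_mono[OF K1 C] K1 by (simp add: A_def divide_le_eq)
  ultimately have K2: "16 * A \<le> \<eta> * K" by linarith
  obtain e0 where e0: "e0 > 0"
    "\<And>e s. e \<ge> e0 \<Longrightarrow> K * exp (\<eta> * s) * (1 + exp s) \<le> sqrt c0 + e * exp ((2*\<eta>+1) * s)"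
    using weight_dominates[OF \<eta>, of "sqrt c0" K] c0 K1 by auto
  \<comment> \<open>The first bound gives the domination by W, the second makes G 0 at least 1 +
    |M|.\<close>
  define e where "e = max e0 (2 * (1 + \<bar>M\<bar>))"
  have e: "e \<ge> e0" "e \<ge> 2 * (1 + \<bar>M\<bar>)" by (auto simp: e_def)
  define W where "W s = sqrt c0 + e * exp (N * s)" for s
  have W: "W s \<ge> K * exp (\<eta> * s) * (1 + exp s)" for s
    using e0(2)[OF e(1), of s] by (simp add: W_def N_eq)
  have W0: "W s > 0" for s
    using e0(1) e(1) c0 by (simp add: W_def add_pos_pos)
  have W1: "W s \<ge> K * exp (\<eta> * s)" for s
  proof -
    have "K * exp (\<eta> * s) * 1 \<le> K * exp (\<eta> * s) * (1 + exp s)"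
      using K1 by (intro mult_left_mono) auto
    then show ?thesis using W[of s] by simp
  qed
  have W_cont: "continuous_on UNIV W" unfolding W_def by (intro continuous_intros)
  \<comment> \<open>These are determined by the system: N Q must be the numerator of the 1/G term in
    X', and P + Q that of the 1/G term in G'.\<close>
  define P Q where "P s = m / 4 + lam * exp s * ((N + 1) / (4 * N))"
    and "Q s = m / 4 + lam * exp s * ((N - 1) / (4 * N))" for s
  \<comment> \<open>The parameter \<theta> stands for (N + 1) / (4 N) and (N - 1) / (4 N), both in
    [0, 1/2] because N > 1.\<close>
  have frac: "\<bar>(m / 4 + lam * exp s * \<theta>) / W s\<bar> \<le> A * exp (- \<eta> * s)"
    if \<theta>: "0 \<le> \<theta>" "\<theta> \<le> 1 / 2" for s \<theta>
  proof -
    have "lam * exp s * \<theta> \<le> lam * exp s * (1/2)"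
      using \<theta> lam by (intro mult_left_mono) auto
    moreover have "C * (1 + exp s) = m / 4 + lam * exp s * (1/2) + (lam / 2 + m / 4 * exp s)"
      by (simp add: C_def field_simps)
    moreover have "lam / 2 + m / 4 * exp s \<ge> 0" using m lam by simp
    ultimately have 1: "m / 4 + lam * exp s * \<theta> \<le> C * (1 + exp s)" by linarith
    have "(m / 4 + lam * exp s * \<theta>) / W s \<le> C * (1 + exp s) / (K * exp (\<eta> * s) * (1 + exp s))"
      using 1 W[of s] K1 C by (intro frac_le) (auto intro!: mult_pos_pos add_pos_pos)
    also have "\<dots> = C / (K * exp (\<eta> * s))"
      by (rule mult_divide_mult_cancel_right) (simp add: add_pos_pos less_imp_neq[THEN not_sym])
    also have "\<dots> = A * exp (- \<eta> * s)"
      by (simp add: A_def exp_minus divide_inverse mult_ac)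
    finally show ?thesis using W0[of s] m lam \<theta>(1) by simp
  qed
  have P_bound: "\<bar>P s / W s\<bar> \<le> A * exp (- \<eta> * s)" and Q_bound: "\<bar>Q s / W s\<bar> \<le> A * exp (- \<eta> * s)" for s
    using N unfolding P_def Q_def by (intro frac; simp add: field_simps)+
  define a b where "a s = exp ((N - 1) * s) * (P s / W s)" and "b s = exp (- s) * (Q s / W s)" for s
  have a_bound: "\<bar>a s\<bar> \<le> A * exp (\<eta> * s)" for s
  proof -
    have "\<bar>a s\<bar> \<le> exp ((N - 1) * s) * (A * exp (- \<eta> * s))"
      using P_bound[of s] by (simp only: a_def abs_mult abs_exp_cancel) (intro mult_left_mono, auto)
    also have "\<dots> = A * exp ((N - 1) * s + - \<eta> * s)" by (simp only: exp_add mult_ac)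
    also have "(N - 1) * s + - \<eta> * s = \<eta> * s" by (simp add: N_eq algebra_simps)
    finally show ?thesis .
  qed
  have b_bound: "\<bar>b s\<bar> \<le> A * exp (- (\<eta> + 1) * s)" for s
  proof -
    have "\<bar>b s\<bar> \<le> exp (- s) * (A * exp (- \<eta> * s))"
      using Q_bound[of s] by (simp only: b_def abs_mult abs_exp_cancel) (intro mult_left_mono, auto)
    also have "\<dots> = A * exp (- s + - \<eta> * s)" by (simp only: exp_add mult_ac)
    also have "- s + - \<eta> * s = - (\<eta> + 1) * s" by (simp add: algebra_simps)
    finally show ?thesis .
  qed
  have W_nz: "W s \<noteq> 0" for s using W0[of s] by simp
  have ab_cont: "continuous_on UNIV a" "continuous_on UNIV b"
    unfolding a_def b_def P_def Q_def by (intro continuous_intros W_cont; simp add: W_nz)+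
  obtain \<phi> where \<phi>: "continuous_on UNIV \<phi>" "\<And>t. \<phi> t \<ge> 1/2"
    and fixpoint: "\<And>t. \<phi> t * W t = W t + tail (\<lambda>s. a (- s) / \<phi> (- s)) (- t)
        - exp ((2*\<eta>+1) * t) * tail (\<lambda>s. b s / \<phi> s) t"
    and close: "\<And>t. \<bar>\<phi> t * W t - W t\<bar> \<le> 4 * A / \<eta> * exp (\<eta> * t)"
    using tail_fixed_point[OF ab_cont W_cont \<eta> A _ K2 a_bound b_bound W1] K1 by auto
  have \<phi>_nz: "\<phi> t \<noteq> 0" for t using \<phi>(2)[of t] by auto
  have quot: "\<bar>x / \<phi> t\<bar> \<le> 2 * y" if "\<bar>x\<bar> \<le> y" for x y t
  proof -
    have "\<bar>x\<bar> / \<bar>\<phi> t\<bar> \<le> y / (1/2)"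
      using \<phi>(2)[of t] that by (intro frac_le) auto
    then show ?thesis by simp
  qed
  define J1 J2 where "J1 = tail (\<lambda>s. a (- s) / \<phi> (- s))" and "J2 = tail (\<lambda>s. b s / \<phi> s)"
  have J1': "(J1 has_real_derivative - (a t / \<phi> t)) (at (- t))" for t
  proof -
    have "continuous_on UNIV (\<lambda>s. a (- s) / \<phi> (- s))"
      by (intro continuous_intros continuous_on_compose2[OF ab_cont(1)]
          continuous_on_compose2[OF \<phi>(1)]) (auto simp: \<phi>_nz)
    moreover have "\<bar>a (- s) / \<phi> (- s)\<bar> \<le> 2 * A * exp (- \<eta> * s)" for s
      using quot[OF a_bound[of "- s"], of "- s"] by simp
    ultimately show ?thesis
      using tail_has_derivative[OF _ \<eta>, of "\<lambda>s. a (- s) / \<phi> (- s)" "2 * A" "- t"]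
      by (simp add: J1_def)
  qed
  have J2': "(J2 has_real_derivative - (b t / \<phi> t)) (at t)" for t
  proof -
    have "continuous_on UNIV (\<lambda>s. b s / \<phi> s)"
      by (intro continuous_intros ab_cont \<phi>) (auto simp: \<phi>_nz)
    moreover have "\<bar>b s / \<phi> s\<bar> \<le> 2 * A * exp (- (\<eta> + 1) * s)" for s
      using quot[OF b_bound[of s], of s] by simp
    ultimately show ?thesis
      using tail_has_derivative[of "\<lambda>s. b s / \<phi> s" "\<eta> + 1" "2 * A" t] \<eta>
      by (simp add: J2_def)
  qed
  define G where "G t = W t + J1 (- t) - exp (N * t) * J2 t" for t
  \<comment> \<open>This is the part of G' that comes from differentiating exp (N t) alone, in W and
    in the \<open>J2\<close> term. The derivatives of \<open>J1\<close> and \<open>J2\<close> supply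
    the 1/G term.\<close>
  define X where "X t = N * exp (N * t) * (e - J2 t)" for t
  have G_eq: "G t = \<phi> t * W t" for t
    using fixpoint[of t] by (simp add: G_def J1_def J2_def N_eq)
  have G_ge: "G t \<ge> W t / 2" for t
    using mult_right_mono[OF \<phi>(2)[of t], of "W t"] W0[of t] by (simp add: G_eq)
  have G_pos: "G t > 0" for t
    using G_ge[of t] W0[of t] by simp
  have a_quot: "a t / \<phi> t = exp ((N - 1) * t) * P t / G t" for t
    by (simp add: a_def G_eq)
  have b_quot: "exp (N * t) * (b t / \<phi> t) = exp ((N - 1) * t) * Q t / G t" for t
  proof -
    have "exp (N * t) * exp (- t) = exp ((N - 1) * t)"
      unfolding exp_add[symmetric] by (simp add: algebra_simps)
    then show ?thesis by (simp add: b_def G_eq mult.assoc[symmetric])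
  qed
  have G': "(G has_real_derivative
      X t + exp ((N - 1) * t) * (lam * exp t + m) / (2 * G t)) (at t)" for t
  proof -
    have "((\<lambda>t. J1 (- t)) has_real_derivative a t / \<phi> t) (at t)"
      using DERIV_chain2[where g = uminus and f = J1, OF J1'[of t] DERIV_minus[OF DERIV_ident]]
      by simp
    then have "(G has_real_derivative X t + (a t / \<phi> t + exp (N * t) * (b t / \<phi> t))) (at t)"
      unfolding G_def[abs_def] W_def X_def
      by (auto intro!: derivative_eq_intros J2' simp: algebra_simps)
    also have "a t / \<phi> t + exp (N * t) * (b t / \<phi> t) = exp ((N - 1) * t) * (P t + Q t) / G t"
      unfolding a_quot b_quot by (simp add: add_divide_distrib distrib_left)
    also have "P t + Q t = (lam * exp t + m) / 2"
      using N by (simp add: P_def Q_def field_simps)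
    finally show ?thesis by (simp add: mult_ac)
  qed
  have X': "(X has_real_derivative
      N * X t + exp ((N - 1) * t) * (m * N + lam * exp t * (N - 1)) / (4 * G t)) (at t)" for t
  proof -
    have "(X has_real_derivative N * X t + N * (exp (N * t) * (b t / \<phi> t))) (at t)"
      unfolding X_def[abs_def]
      by (auto intro!: derivative_eq_intros J2' simp: algebra_simps)
    also have "N * (exp (N * t) * (b t / \<phi> t)) = exp ((N - 1) * t) * (N * Q t) / G t"
      unfolding b_quot by simp
    also have "N * Q t = (m * N + lam * exp t * (N - 1)) / 4"
      using N by (simp add: Q_def field_simps)
    finally show ?thesis by (simp add: mult_ac)
  qed
  have exp_lim: "((\<lambda>t. k * exp (p * t)) \<longlongrightarrow> 0) at_bot" if "p > 0" for k p :: real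
    using that by (intro tendsto_mult_right_zero filterlim_compose[OF exp_at_bot]
        filterlim_tendsto_pos_mult_at_bot[OF tendsto_const] filterlim_ident)
  \<comment> \<open>The difference is at most a multiple of exp (\<eta> t), so G inherits the limit
    of W.\<close>
  have "((\<lambda>t. G t - W t) \<longlongrightarrow> 0) at_bot"
    using exp_lim[OF \<eta>, of "4 * A / \<eta>"]
    by (rule Lim_null_comparison[rotated]) (use close in \<open>simp add: G_eq\<close>)
  moreover have "(W \<longlongrightarrow> sqrt c0) at_bot"
    using tendsto_add[OF tendsto_const exp_lim[of N e], of "sqrt c0"] N by (simp add: W_def[abs_def])
  ultimately have "(G \<longlongrightarrow> sqrt c0) at_bot"
    using tendsto_add[of "\<lambda>t. G t - W t" 0 at_bot W "sqrt c0"] by simp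
  from integral_system_in_solutions[where G = G and n = n, OF c0 G_pos, folded N_def m_def, OF G' X' this]
  have "(\<lambda>r\<in>{0<..}. r powr (1 - N) * (G (ln r))\<^sup>2) \<in> solutions n lam c0" .
  moreover have "(\<lambda>r\<in>{0<..}. r powr (1 - N) * (G (ln r))\<^sup>2) 1 \<ge> M"
  proof -
    have "G 0 \<ge> 1 + \<bar>M\<bar>"
    proof -
      have "sqrt c0 + e \<le> 2 * G 0" using G_ge[of 0] by (simp add: W_def)
      then have "e \<le> 2 * G 0" using real_sqrt_gt_zero[OF c0] by linarith
      with e(2) have "2 * (1 + \<bar>M\<bar>) \<le> 2 * G 0" by (rule order_trans)
      then show ?thesis by simp
    qed
    then have "(G 0)\<^sup>2 \<ge> (1 + \<bar>M\<bar>)\<^sup>2" by (intro power_mono) auto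
    moreover have "(1 + \<bar>M\<bar>)\<^sup>2 = 1 + 2 * \<bar>M\<bar> + \<bar>M\<bar>\<^sup>2" by (simp add: power2_sum)
    ultimately have "(G 0)\<^sup>2 \<ge> M" using zero_le_power2[of "\<bar>M\<bar>"] by linarith
    then show ?thesis by simp
  qed
  ultimately show ?thesis by (rule that)
qed

theorem mainTheorem5:
  fixes n :: nat and lam c0 :: real
  assumes "n \<ge> 2" and "lam \<ge> 0" and "c0 > 0"
  shows "infinite (solutions n lam c0)"
proof
  assume fin: "finite (solutions n lam c0)"
  \<comment> \<open>The values at r = 1 are unbounded over the solution set, whereas a finite set
    would give them a maximum.\<close>
  obtain h where h: "h \<in> solutions n lam c0"
    "h 1 \<ge> Max ((\<lambda>h. h 1) ` solutions n lam c0) + 1"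
    using solution_with_large_value[OF assms] by blast
  have "h 1 \<le> Max ((\<lambda>h. h 1) ` solutions n lam c0)"
    using fin h(1) by (intro Max_ge) auto
  then show False using h(2) by linarith
qed

end
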